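(* Let $x$ and $y$ be two real numbers that are not $\infty$-rationals, with EICF expansions \[ x=[a_1,a_2,\dotsc]\quad\text{and}\quad y=[b_1,b_2,\dotsc]. \] Then $x$ and $y$ are equivalent under $\widetilde\Theta$ if and only if there are positive integers $m$ and $n$ such that either $a_{m+i}=b_{n+i}$ for $i=1,2,\dotsc$, or $a_{m+i}=-b_{n+i}$ for $i=1,2,\dotsc$.
   Context: $\mathbb{R}_\infty=\mathbb{R}\cup\{\infty\}$ is the extended real line. The extended theta group $\widetilde\Theta$ is the group generated by the transformations $s(z)=-1/z$, $h(z)=z+2$ and $r(z)=-z$, acting on $\mathbb{R}_\infty$. Two real numbers are equivalent under $\widetilde\Theta$ if they lie in the same orbit of this action. The $\infty$-rationals are the rationals $a/b$ in reduced form ($a,b$ coprime integers, $b>0$) whose numerator and denominator differ in parity, together with the point $\infty$. An even-integer continued fraction (EICF) is a finite, infinite or empty sequence $[b_1,b_2,\dotsc]$ of even integers all of whose terms, except possibly $b_1$, are nonzero. The value of a finite EICF $[b_1,\dots,b_n]$ ($n\geq 1$) is the number $b_1+\cfrac{1}{b_2+\cfrac{1}{b_3+\cdots+\cfrac{1}{b_n}}}$. The convergents of an EICF $[b_1,b_2,\dotsc]$ are the values of $[b_1,\dots,b_n]$ for $n=1,2,\dotsc$. An infinite EICF has value $x$ if its sequence of convergents converges to $x$ in $\mathbb{R}_\infty$. An EICF expansion of a real number $x$ is an EICF with value $x$. Every real number that is not an $\infty$-rational has an EICF expansion, and all its EICF expansions are infinite; the expansion is unique if the number is irrational, while a reduced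 rational with odd numerator and denominator has exactly two. *)

theory Defs
  imports "HOL-Analysis.Analysis" "HOL-Algebra.Group_Action" "HOL-Algebra.Generated_Groups"
begin

text \<open>
  The extended real line has a single point at infinity: it is the one-point compactification
  of the real line, with \<open>None\<close> as the point at infinity.
\<close>

type_synonym ext_real_line = "real option"

abbreviation ext_real_line_top :: "ext_real_line topology" where
  "ext_real_line_top \<equiv> Alexandroff_compactification euclideanreal"

definition theta_s :: "ext_real_line \<Rightarrow> ext_real_line" where
  "theta_s z = (case z of None \<Rightarrow> Some 0 | Some t \<Rightarrow> if t = 0 then None else Some (- 1 / t))"

definition theta_h :: "ext_real_line \<Rightarrow> ext_real_line" where
  "theta_h = map_option (\<lambda>t. t + 2)"

definition theta_r :: "ext_real_line \<Rightarrow> ext_real_line" where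
  "theta_r = map_option uminus"

definition ext_theta_group :: "(ext_real_line \<Rightarrow> ext_real_line) monoid" where
  "ext_theta_group =
     (BijGroup UNIV)\<lparr>carrier := generate (BijGroup UNIV) {theta_s, theta_h, theta_r}\<rparr>"

definition theta_equivalent :: "real \<Rightarrow> real \<Rightarrow> bool" where
  "theta_equivalent x y \<longleftrightarrow>
     (\<exists>\<Omega> \<in> orbits ext_theta_group UNIV (\<lambda>g. g). Some x \<in> \<Omega> \<and> Some y \<in> \<Omega>)"

definition infty_rationals :: "ext_real_line set" where
  "infty_rationals =
     insert None {Some (of_int a / of_int b) | a b. coprime a b \<and> b > 0 \<and> even a \<noteq> even b}"

text \<open>
  Finite (possibly empty) and infinite integer sequences. In \<open>Infinite b\<close> the terms are
  \<open>b 1, b 2, \<dots>\<close>; the entry \<open>b 0\<close> is never used.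
\<close>

datatype int_sequence = Finite "int list" | Infinite "nat \<Rightarrow> int"

fun is_eicf :: "int_sequence \<Rightarrow> bool" where
  "is_eicf (Finite bs) \<longleftrightarrow> (\<forall>b \<in> set bs. even b) \<and> (\<forall>b \<in> set (tl bs). b \<noteq> 0)"
| "is_eicf (Infinite b) \<longleftrightarrow> (\<forall>i \<ge> 1. even (b i)) \<and> (\<forall>i \<ge> 2. b i \<noteq> 0)"

text \<open>
  Only nonempty lists are given a value. No division by zero occurs when the list is an EICF,
  see \<open>cf_value_tail\<close> below.
\<close>

fun cf_value :: "int list \<Rightarrow> real" where
  "cf_value [b] = of_int b"
| "cf_value (b # c # bs) = of_int b + 1 / cf_value (c # bs)"

definition cf_convergent :: "(nat \<Rightarrow> int) \<Rightarrow> nat \<Rightarrow> real" where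
  "cf_convergent b n = cf_value (map b [1..<n + 1])"

fun has_value :: "int_sequence \<Rightarrow> ext_real_line \<Rightarrow> bool" where
  "has_value (Finite bs) v \<longleftrightarrow> bs \<noteq> [] \<and> v = Some (cf_value bs)"
| "has_value (Infinite b) v \<longleftrightarrow>
     limitin ext_real_line_top (\<lambda>n. Some (cf_convergent b n)) v sequentially"

definition eicf_expansion :: "int_sequence \<Rightarrow> real \<Rightarrow> bool" where
  "eicf_expansion c x \<longleftrightarrow> is_eicf c \<and> has_value c (Some x)"

lemma theta_generators_Bij: "{theta_s, theta_h, theta_r} \<subseteq> Bij UNIV"
proof -
  have "theta_s (theta_s z) = z" for z
    by (auto simp: theta_s_def split: option.splits)
  then have s: "bij theta_s"
    by (intro o_bij[of theta_s]) auto
  have h: "bij theta_h"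
    by (rule o_bij[of "map_option (\<lambda>t. t - 2)"])
       (auto simp: theta_h_def fun_eq_iff option.map_comp o_def option.map_ident)
  have r: "bij theta_r"
    by (rule o_bij[of theta_r])
       (auto simp: theta_r_def fun_eq_iff option.map_comp o_def option.map_ident)
  show ?thesis
    using s h r by (auto simp: Bij_def extensional_def)
qed

lemma subgroup_ext_theta: "subgroup (carrier ext_theta_group) (BijGroup UNIV)"
proof -
  have "{theta_s, theta_h, theta_r} \<subseteq> carrier (BijGroup UNIV)"
    using theta_generators_Bij by (simp add: BijGroup_def)
  from group.generate_is_subgroup[OF group_BijGroup this] show ?thesis
    by (simp add: ext_theta_group_def)
qed

lemma cf_value_tail:
  assumes "bs \<noteq> []" "\<forall>b \<in> set bs. even b \<and> b \<noteq> 0"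
  shows "\<bar>cf_value bs\<bar> > 1"
  using assms
proof (induction bs rule: cf_value.induct)
  case (1 b)
  then have "\<bar>b\<bar> > 1" by (auto elim!: evenE)
  then show ?case by simp
next
  case (2 b c bs)
  then have t: "\<bar>cf_value (c # bs)\<bar> > 1" by simp
  have "\<bar>b\<bar> \<ge> 2" using 2 by (auto elim!: evenE)
  then have b: "\<bar>real_of_int b\<bar> \<ge> 2" by linarith
  have "\<bar>1 / cf_value (c # bs)\<bar> < 1" using t by (simp add: abs_divide)
  then show ?case unfolding cf_value.simps using b by linarith
qed simp

end

theory Submission
  imports Defs
begin

text \<open>
  Each generator of the group changes an expansion of \<open>x\<close> into an expansion of the image of \<open>x\<close>
  by changing, inserting or dropping the first term and possibly negating all terms, so every group
  element preserves tails up to sign. Conversely \<open>x = a\<^sub>1 + 1 / x\<^sub>1\<close> is equivalent to the value \<open>x\<^sub>1\<close> of its tail, so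
  equal or opposite tails give equivalent numbers. What remains is that two expansions of the same
  number share a tail up to sign: at the first place where they differ, two numbers of absolute
  value at least 1 have reciprocals differing by at least 2, so these numbers are 1 and -1, whose
  expansions with nonzero first term are forced to be \<open>[2, -2, 2, \<dots>]\<close> and \<open>[-2, 2, -2, \<dots>]\<close>.
\<close>

section \<open>Infinity-rationals\<close>

text \<open>Dropping the sign condition on the denominator lets the quotient be inverted by swapping
  \<open>a\<close> and \<open>b\<close>. If \<open>b\<close> is negative, changing both signs
  restores the condition.\<close>

lemma Some_infty_rationals_iff:
  "Some x \<in> infty_rationals \<longleftrightarrow>
     (\<exists>a b. coprime a b \<and> b \<noteq> 0 \<and> even a \<noteq> even b \<and> x = of_int a / of_int b)"
proof
  assume "\<exists>a b. coprime a b \<and> b \<noteq> 0 \<and> even a \<noteq> even b \<and> x = of_int a / of_int b"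
  then obtain a b :: int where ab: "coprime a b" "b \<noteq> 0" "even a \<noteq> even b" "x = of_int a / of_int b"
    by blast
  show "Some x \<in> infty_rationals"
  proof (cases "b > 0")
    case True
    then show ?thesis using ab by (auto simp: infty_rationals_def)
  next
    case False
    then have "coprime (-a) (-b) \<and> -b > 0 \<and> even (-a) \<noteq> even (-b) \<and> x = of_int (-a) / of_int (-b)"
      using ab by simp
    then show ?thesis unfolding infty_rationals_def by blast
  qed
qed (auto simp: infty_rationals_def)

lemma even_infty_rational:
  assumes "even k"
  shows "Some (of_int k) \<in> infty_rationals"
  unfolding Some_infty_rationals_iff using assms by (intro exI[of _ k] exI[of _ 1]) auto

lemma infty_rational_uminus:
  assumes "Some x \<in> infty_rationals"
  shows "Some (- x) \<in> infty_rationals"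
proof -
  obtain a b :: int where ab: "coprime a b" "b \<noteq> 0" "even a \<noteq> even b" "x = of_int a / of_int b"
    using assms unfolding Some_infty_rationals_iff by blast
  then show ?thesis
    unfolding Some_infty_rationals_iff by (intro exI[of _ "-a"] exI[of _ b]) auto
qed

lemma infty_rational_inverse:
  assumes "Some x \<in> infty_rationals"
  shows "Some (1 / x) \<in> infty_rationals"
proof (cases "x = 0")
  case True
  then show ?thesis using even_infty_rational[of 0] by simp
next
  case False
  obtain a b :: int where ab: "coprime a b" "b \<noteq> 0" "even a \<noteq> even b" "x = of_int a / of_int b"
    using assms unfolding Some_infty_rationals_iff by blast
  then show ?thesis
    using False unfolding Some_infty_rationals_iff
    by (intro exI[of _ b] exI[of _ a]) (auto simp: coprime_commute)
qed

text \<open>Adding \<open>k * b\<close> with \<open>k\<close> even to the numerator changes neither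
  its parity nor its gcd with \<open>b\<close>.\<close>

lemma infty_rational_add_even:
  assumes "Some x \<in> infty_rationals" "even k"
  shows "Some (of_int k + x) \<in> infty_rationals"
proof -
  obtain a b :: int where ab: "coprime a b" "b \<noteq> 0" "even a \<noteq> even b" "x = of_int a / of_int b"
    using assms unfolding Some_infty_rationals_iff by blast
  have "coprime (k * b + a) b"
    using ab(1) by (metis coprime_iff_gcd_eq_1 gcd_add_mult gcd.commute add.commute)
  moreover have "of_int k + x = of_int (k * b + a) / of_int b"
    using ab by (simp add: field_simps)
  ultimately show ?thesis
    unfolding Some_infty_rationals_iff
    using ab assms(2) by (intro exI[of _ "k * b + a"] exI[of _ b]) auto
qed

section \<open>The group action\<close>

text \<open>The orbit relation in terms of a single group element. It lives on the whole extended
  line because orbits there are indexed by arbitrary points, infinity included.\<close>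

definition theta_related :: "ext_real_line \<Rightarrow> ext_real_line \<Rightarrow> bool" where
  "theta_related u v \<longleftrightarrow> (\<exists>g \<in> carrier ext_theta_group. g u = v)"

lemma carrier_ext_theta_Bij:
  assumes "g \<in> carrier ext_theta_group"
  shows "g \<in> Bij UNIV"
  using subgroup.subset[OF subgroup_ext_theta] assms by (auto simp: BijGroup_def)

lemma mult_BijGroup_UNIV:
  assumes "f \<in> Bij UNIV" "g \<in> Bij UNIV"
  shows "f \<otimes>\<^bsub>BijGroup UNIV\<^esub> g = f \<circ> g"
  using assms by (simp add: BijGroup_def compose_def fun_eq_iff)

lemma inv_BijGroup_UNIV:
  assumes "f \<in> Bij UNIV"
  shows "inv\<^bsub>BijGroup UNIV\<^esub> f = inv_into UNIV f"
  using inv_BijGroup[OF assms] by (simp add: restrict_def)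

lemma one_BijGroup_UNIV: "\<one>\<^bsub>BijGroup UNIV\<^esub> = (\<lambda>x. x)"
  by (simp add: BijGroup_def restrict_def)

lemma theta_related_refl: "theta_related u u"
  using subgroup.one_closed[OF subgroup_ext_theta]
  unfolding theta_related_def one_BijGroup_UNIV by (intro bexI[of _ "\<lambda>x. x"]) simp_all

lemma theta_related_trans:
  assumes "theta_related u v" "theta_related v w"
  shows "theta_related u w"
proof -
  obtain f g where fg: "f \<in> carrier ext_theta_group" "g \<in> carrier ext_theta_group" "f u = v" "g v = w"
    using assms unfolding theta_related_def by blast
  have "g \<circ> f \<in> carrier ext_theta_group"
    using subgroup.m_closed[OF subgroup_ext_theta fg(2,1)]
    by (simp add: mult_BijGroup_UNIV carrier_ext_theta_Bij fg)
  then show ?thesis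
    unfolding theta_related_def using fg by (intro bexI[of _ "g \<circ> f"]) auto
qed

lemma theta_related_sym:
  assumes "theta_related u v"
  shows "theta_related v u"
proof -
  obtain f where f: "f \<in> carrier ext_theta_group" "f u = v"
    using assms unfolding theta_related_def by blast
  have B: "f \<in> Bij UNIV" using f carrier_ext_theta_Bij by blast
  have "inv_into UNIV f \<in> carrier ext_theta_group"
    using subgroup.m_inv_closed[OF subgroup_ext_theta f(1)] by (simp add: inv_BijGroup_UNIV B)
  moreover have "inv_into UNIV f v = u"
    using B f by (auto simp: Bij_def bij_betw_def)
  ultimately show ?thesis unfolding theta_related_def by blast
qed

lemma theta_equivalent_iff: "theta_equivalent x y \<longleftrightarrow> theta_related (Some x) (Some y)"
proof -
  have "orbits ext_theta_group UNIV (\<lambda>g. g) = range (\<lambda>z. {v. theta_related z v})"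
    by (auto simp: orbits_def orbit_def theta_related_def image_def Bex_def eq_commute conj_commute)
  then have "theta_equivalent x y \<longleftrightarrow> (\<exists>z. theta_related z (Some x) \<and> theta_related z (Some y))"
    by (simp add: theta_equivalent_def)
  also have "\<dots> \<longleftrightarrow> theta_related (Some x) (Some y)"
    by (meson theta_related_refl theta_related_sym theta_related_trans)
  finally show ?thesis .
qed

lemma theta_related_generator:
  assumes "g \<in> {theta_s, theta_h, theta_r}"
  shows "theta_related u (g u)"
proof -
  have "g \<in> carrier ext_theta_group"
    using generate.incl[OF assms] by (simp add: ext_theta_group_def)
  then show ?thesis unfolding theta_related_def by blast
qed

lemma theta_related_uminus: "theta_related (Some x) (Some (- x))"
  using theta_related_generator[of theta_r "Some x"] by (simp add: theta_r_def)

lemma theta_related_inverse: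
  assumes "x \<noteq> 0"
  shows "theta_related (Some x) (Some (1 / x))"
proof (rule theta_related_trans)
  show "theta_related (Some x) (Some (- 1 / x))"
    using theta_related_generator[of theta_s "Some x"] assms by (simp add: theta_s_def)
  show "theta_related (Some (- 1 / x)) (Some (1 / x))"
    using theta_related_uminus[of "- 1 / x"] by simp
qed

lemma theta_related_add_even:
  assumes "even k"
  shows "theta_related (Some x) (Some (of_int k + x))"
proof -
  \<comment> \<open>Powers of \<open>theta_h\<close> give the nonnegative shifts; a negative shift
    is a nonnegative one read backwards, starting from the shifted point.\<close>
  have nat: "theta_related (Some x) (Some (2 * of_nat n + x))" for n x
  proof (induction n)
    case 0
    then show ?case by (simp add: theta_related_refl)
  next
    case (Suc n)
    have "theta_related (Some (2 * of_nat n + x)) (Some (2 * of_nat (Suc n) + x))"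
      using theta_related_generator[of theta_h "Some (2 * of_nat n + x)"]
      by (simp add: theta_h_def algebra_simps)
    then show ?case using Suc theta_related_trans by blast
  qed
  obtain j where j: "k = 2 * j" using assms by blast
  show ?thesis
  proof (cases "j \<ge> 0")
    case True
    then show ?thesis using nat[of x "nat j"] j by simp
  next
    case False
    then have "theta_related (Some (of_int k + x)) (Some x)"
      using nat[of "of_int k + x" "nat (- j)"] j by simp
    then show ?thesis by (rule theta_related_sym)
  qed
qed

section \<open>Expansions of numbers that are not infinity-rationals\<close>

lemma cf_convergent_Suc_Suc:
  "cf_convergent b (Suc (Suc n)) = of_int (b 1) + 1 / cf_convergent (\<lambda>i. b (Suc i)) (Suc n)"
proof -
  have "map b [1..<Suc (Suc n) + 1] = b 1 # map (\<lambda>i. b (Suc i)) [1..<Suc n + 1]"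
    by (simp add: upt_conv_Cons map_Suc_upt[symmetric] del: upt_Suc map_Suc_upt)
  moreover have "map (\<lambda>i. b (Suc i)) [1..<Suc n + 1] = b 2 # map (\<lambda>i. b (Suc i)) [2..<Suc n + 1]"
    by (simp add: upt_conv_Cons numeral_2_eq_2 del: upt_Suc)
  ultimately show ?thesis
    unfolding cf_convergent_def by (simp del: upt_Suc)
qed

lemma cf_convergent_1: "cf_convergent b (Suc 0) = of_int (b 1)"
  by (simp add: cf_convergent_def)

lemma cf_convergent_uminus: "cf_convergent (\<lambda>i. - b i) (Suc n) = - cf_convergent b (Suc n)"
  by (induction n arbitrary: b) (simp_all add: cf_convergent_1 cf_convergent_Suc_Suc)

text \<open>\<open>Some\<close> is an open embedding of the real line into its one-point
  compactification, so for a finite limit the two notions of convergence coincide. Openness gives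
  one direction, continuity the other.\<close>

lemma has_value_Infinite_iff:
  "has_value (Infinite b) (Some x) \<longleftrightarrow> cf_convergent b \<longlonglongrightarrow> x"
proof
  assume lim: "has_value (Infinite b) (Some x)"
  have "limitin euclideanreal (cf_convergent b) x sequentially"
    unfolding limitin_def
  proof (intro conjI allI impI)
    fix U assume "openin euclideanreal U \<and> x \<in> U"
    then have "openin ext_real_line_top (Some ` U)" "Some x \<in> Some ` U" by simp_all
    then have "\<forall>\<^sub>F n in sequentially. Some (cf_convergent b n) \<in> Some ` U"
      using lim by (simp add: limitin_def)
    then show "\<forall>\<^sub>F n in sequentially. cf_convergent b n \<in> U"
      by (rule eventually_mono) auto
  qed simp
  then show "cf_convergent b \<longlonglongrightarrow> x" by simp
next
  assume "cf_convergent b \<longlonglongrightarrow> x"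
  then show "has_value (Infinite b) (Some x)"
    using continuous_map_limit[OF continuous_map_Some, of euclideanreal "cf_convergent b" x sequentially]
    by (simp add: o_def)
qed

text \<open>The condition on \<open>x\<close> is kept because it passes to tails and rules out even
  integers, so that no denominator \<open>x - b 1\<close> vanishes.\<close>

definition eicf_proper :: "(nat \<Rightarrow> int) \<Rightarrow> real \<Rightarrow> bool" where
  "eicf_proper b x \<longleftrightarrow> eicf_expansion (Infinite b) x \<and> Some x \<notin> infty_rationals"

text \<open>The shift to \<open>Suc n\<close> avoids \<open>cf_convergent b 0\<close>, the
  unspecified value of the empty list, and leaves the limit unchanged.\<close>

lemma eicf_proper_iff:
  "eicf_proper b x \<longleftrightarrow>
     (\<forall>i \<ge> 1. even (b i)) \<and> (\<forall>i \<ge> 2. b i \<noteq> 0) \<and>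
     (\<lambda>n. cf_convergent b (Suc n)) \<longlonglongrightarrow> x \<and> Some x \<notin> infty_rationals"
  by (simp only: eicf_proper_def eicf_expansion_def has_value_Infinite_iff is_eicf.simps
      filterlim_sequentially_Suc[of "cf_convergent b"] conj_assoc)

lemma eicf_proper_uminus:
  assumes "eicf_proper b x"
  shows "eicf_proper (\<lambda>i. - b i) (- x)"
  using assms infty_rational_uminus[of "- x"]
  unfolding eicf_proper_iff cf_convergent_uminus
  by (auto simp del: filterlim_sequentially_Suc intro: tendsto_minus)

lemma eicf_proper_neq_even:
  assumes "eicf_proper b x" "even k"
  shows "x \<noteq> of_int k"
  using assms even_infty_rational by (auto simp: eicf_proper_def)

text \<open>The map sending \<open>t\<close> to \<open>1 / (t - b 1)\<close> takes convergents to
  convergents of the tail and is continuous at \<open>x\<close>, which is no even integer. If the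
  new value were an infinity-rational, undoing the map would make \<open>x\<close> one.\<close>

lemma eicf_proper_tail:
  assumes "eicf_proper b x"
  shows "eicf_proper (\<lambda>i. b (Suc i)) (1 / (x - of_int (b 1)))"
proof -
  have ev: "even (b 1)" using assms by (simp add: eicf_proper_iff)
  then have ne: "x - of_int (b 1) \<noteq> 0" using eicf_proper_neq_even[OF assms] by simp
  have "(\<lambda>n. cf_convergent b (Suc (Suc n))) \<longlonglongrightarrow> x"
    using assms LIMSEQ_Suc[of "\<lambda>n. cf_convergent b (Suc n)"] unfolding eicf_proper_iff by blast
  then have "(\<lambda>n. 1 / (cf_convergent b (Suc (Suc n)) - of_int (b 1))) \<longlonglongrightarrow> 1 / (x - of_int (b 1))"
    using ne by (intro tendsto_intros)
  then have "(\<lambda>n. cf_convergent (\<lambda>i. b (Suc i)) (Suc n)) \<longlonglongrightarrow> 1 / (x - of_int (b 1))"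
    by (simp add: cf_convergent_Suc_Suc)
  moreover have "Some (1 / (x - of_int (b 1))) \<notin> infty_rationals"
  proof
    assume "Some (1 / (x - of_int (b 1))) \<in> infty_rationals"
    from infty_rational_add_even[OF infty_rational_inverse[OF this] ev] assms
    show False by (simp add: eicf_proper_iff)
  qed
  ultimately show ?thesis
    using assms by (simp add: eicf_proper_iff)
qed

lemma theta_related_tail:
  assumes "eicf_proper b x"
  shows "theta_related (Some x) (Some (1 / (x - of_int (b 1))))"
proof -
  have ev: "even (b 1)" using assms by (simp add: eicf_proper_iff)
  then have "x - of_int (b 1) \<noteq> 0" using eicf_proper_neq_even[OF assms] by simp
  then show ?thesis
    using theta_related_trans[OF theta_related_add_even[of "- b 1" x] theta_related_inverse] ev
    by simp
qed

definition eicf_cons :: "int \<Rightarrow> (nat \<Rightarrow> int) \<Rightarrow> nat \<Rightarrow> int" where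
  "eicf_cons k b i = (if i \<le> 1 then k else b (i - 1))"

lemma eicf_proper_cons:
  assumes "eicf_proper b x" "b 1 \<noteq> 0" "even k"
  shows "eicf_proper (eicf_cons k b) (of_int k + 1 / x)"
proof -
  have ne: "x \<noteq> 0" using eicf_proper_neq_even[OF assms(1), of 0] by simp
  have conv: "cf_convergent (eicf_cons k b) (Suc (Suc n)) = of_int k + 1 / cf_convergent b (Suc n)" for n
  proof -
    have "cf_convergent (\<lambda>i. eicf_cons k b (Suc i)) (Suc n) = cf_convergent b (Suc n)"
      unfolding cf_convergent_def
      by (intro arg_cong[of _ _ cf_value] map_cong) (auto simp: eicf_cons_def)
    then show ?thesis by (simp add: cf_convergent_Suc_Suc eicf_cons_def)
  qed
  have "(\<lambda>n. of_int k + 1 / cf_convergent b (Suc n)) \<longlonglongrightarrow> of_int k + 1 / x"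
    using assms(1) ne by (intro tendsto_intros) (auto simp: eicf_proper_iff)
  then have "(\<lambda>n. cf_convergent (eicf_cons k b) (Suc (Suc n))) \<longlonglongrightarrow> of_int k + 1 / x"
    by (simp add: conv)
  then have "(\<lambda>n. cf_convergent (eicf_cons k b) (Suc n)) \<longlonglongrightarrow> of_int k + 1 / x"
    by (rule LIMSEQ_imp_Suc)
  moreover have "Some (of_int k + 1 / x) \<notin> infty_rationals"
  proof
    assume "Some (of_int k + 1 / x) \<in> infty_rationals"
    from infty_rational_inverse[OF infty_rational_add_even[OF this, of "- k"]] assms
    show False by (simp add: eicf_proper_iff)
  qed
  \<comment> \<open>The former first term becomes the second one, which must not be zero; this is
    the case \<open>i = 2\<close>.\<close>
  moreover have "b (i - Suc 0) \<noteq> 0" if "i \<ge> 2" for i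
    using assms that by (cases "i = 2") (auto simp: eicf_proper_iff)
  ultimately show ?thesis
    using assms(1,3) by (auto simp: eicf_proper_iff eicf_cons_def)
qed

text \<open>All convergents have absolute value above 1 by \<open>cf_value_tail\<close>; only the
  weak inequality survives the limit, and \<open>[2, -2, 2, ...]\<close> with value 1 attains
  it.\<close>

lemma eicf_proper_abs_ge_1:
  assumes "eicf_proper b x" "b 1 \<noteq> 0"
  shows "\<bar>x\<bar> \<ge> 1"
proof -
  have ne: "b i \<noteq> 0 \<and> even (b i)" if "i \<ge> 1" for i
    using assms that by (cases "i = 1") (auto simp: eicf_proper_iff)
  have "1 \<le> \<bar>cf_convergent b (Suc n)\<bar>" for n
    unfolding cf_convergent_def using ne
    by (intro less_imp_le cf_value_tail) auto
  moreover have "(\<lambda>n. \<bar>cf_convergent b (Suc n)\<bar>) \<longlonglongrightarrow> \<bar>x\<bar>"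
    using assms(1) by (intro tendsto_rabs) (simp add: eicf_proper_iff)
  ultimately show ?thesis
    by (intro LIMSEQ_le_const) auto
qed

lemma eicf_proper_drop:
  assumes "eicf_proper b x"
  shows "\<exists>u. eicf_proper (\<lambda>i. b (n + i)) u \<and> theta_related (Some x) (Some u)"
proof (induction n)
  case 0
  then show ?case using assms theta_related_refl by auto
next
  case (Suc n)
  then obtain u where "eicf_proper (\<lambda>i. b (n + i)) u" "theta_related (Some x) (Some u)" by blast
  then show ?case
    using eicf_proper_tail[of "\<lambda>i. b (n + i)" u] theta_related_tail[of "\<lambda>i. b (n + i)" u]
      theta_related_trans by auto
qed

lemma eicf_proper_cong:
  assumes "eicf_proper b x" "\<And>i. i \<ge> 1 \<Longrightarrow> c i = b i"
  shows "eicf_proper c x"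
proof -
  have "cf_convergent c n = cf_convergent b n" for n
    unfolding cf_convergent_def using assms(2)
    by (intro arg_cong[of _ _ cf_value] map_cong) auto
  then show ?thesis using assms by (simp add: eicf_proper_iff)
qed

lemma eicf_proper_value_unique:
  assumes "eicf_proper b x" "eicf_proper b y"
  shows "x = y"
  using assms LIMSEQ_unique by (auto simp: eicf_proper_iff)

section \<open>Tails up to sign\<close>

definition tails_agree :: "(nat \<Rightarrow> int) \<Rightarrow> (nat \<Rightarrow> int) \<Rightarrow> bool" where
  "tails_agree a b \<longleftrightarrow>
     (\<exists>m n. m > 0 \<and> n > 0 \<and>
       ((\<forall>i \<ge> 1. a (m + i) = b (n + i)) \<or> (\<forall>i \<ge> 1. a (m + i) = - b (n + i))))"

lemma tails_agree_refl: "tails_agree a a"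
  unfolding tails_agree_def by blast

lemma tails_agree_trans:
  assumes "tails_agree a b" "tails_agree b c"
  shows "tails_agree a c"
proof -
  obtain m n where mn: "m > 0" "n > 0"
      "(\<forall>i \<ge> 1. a (m + i) = b (n + i)) \<or> (\<forall>i \<ge> 1. a (m + i) = - b (n + i))"
    using assms(1) unfolding tails_agree_def by blast
  obtain p q where pq: "p > 0" "q > 0"
      "(\<forall>i \<ge> 1. b (p + i) = c (q + i)) \<or> (\<forall>i \<ge> 1. b (p + i) = - c (q + i))"
    using assms(2) unfolding tails_agree_def by blast
  have shift: "a (m + p + i) = a (m + (p + i))" "b (n + (p + i)) = b (p + (n + i))"
      "c (q + n + i) = c (q + (n + i))" for i
    by (simp_all add: ac_simps)
  \<comment> \<open>The two matched stretches of \<open>b\<close> begin after \<open>n\<close> and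
    after \<open>p\<close>; advancing the first by \<open>p\<close> and the second by
    \<open>n\<close> aligns both after \<open>n + p\<close>, and the signs multiply.\<close>
  have "(\<forall>i \<ge> 1. a (m + p + i) = c (q + n + i)) \<or> (\<forall>i \<ge> 1. a (m + p + i) = - c (q + n + i))"
    using mn(3) pq(3) unfolding shift(1,3)
    by (elim disjE) (simp_all add: shift(2))
  then show ?thesis
    unfolding tails_agree_def using mn(1) pq(2)
    by (intro exI[of _ "m + p"] exI[of _ "q + n"]) auto
qed

section \<open>Two expansions of the same number\<close>

lemma eicf_proper_unit_first:
  assumes "eicf_proper b e" "b 1 \<noteq> 0" "\<bar>e\<bar> = 1"
  shows "of_int (b 1) = 2 * e"
proof -
  have "b 2 \<noteq> 0" using assms(1) by (simp add: eicf_proper_iff)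
  then have "\<bar>1 / (e - of_int (b 1))\<bar> \<ge> 1"
    using eicf_proper_abs_ge_1[OF eicf_proper_tail[OF assms(1)]] by (simp add: numeral_2_eq_2)
  then have le: "\<bar>e - of_int (b 1)\<bar> \<le> 1"
    by (auto simp: abs_divide le_divide_eq split: if_splits)
  have "even (b 1)" using assms(1) by (simp add: eicf_proper_iff)
  then obtain k where k: "b 1 = 2 * k" by blast
  \<comment> \<open>For either sign, \<open>2 * e\<close> is the only nonzero even integer within
    distance 1 of \<open>e\<close>.\<close>
  have "e = 1 \<or> e = -1" using assms(3) by linarith
  then show ?thesis
  proof
    assume e: "e = 1"
    then have "k = 1" using le k assms(2) by simp
    then show ?thesis using e k by simp
  next
    assume e: "e = -1"
    then have "k = -1" using le k assms(2) by simp
    then show ?thesis using e k by simp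
  qed
qed

text \<open>Since the first term is \<open>2 * e\<close>, the tail has value
  \<open>1 / (e - 2 * e) = - e\<close>, again of absolute value 1, so the argument repeats with the
  sign flipped.\<close>

lemma eicf_proper_unit:
  assumes "eicf_proper b e" "b 1 \<noteq> 0" "\<bar>e\<bar> = 1"
  shows "of_int (b (Suc n)) = 2 * e * (-1) ^ n"
  using assms
proof (induction n arbitrary: b e)
  case (0 b e)
  then show ?case using eicf_proper_unit_first[OF 0] by simp
next
  case (Suc n b e)
  have "b 2 \<noteq> 0" using Suc.prems by (simp add: eicf_proper_iff)
  have "e = 1 \<or> e = -1" using Suc.prems by linarith
  then have "1 / (e - of_int (b 1)) = - e"
    unfolding eicf_proper_unit_first[OF Suc.prems] by auto
  then have "eicf_proper (\<lambda>i. b (Suc i)) (- e)"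
    using eicf_proper_tail[OF Suc.prems(1)] by simp
  from Suc.IH[OF this] \<open>b 2 \<noteq> 0\<close> Suc.prems show ?case by (simp add: numeral_2_eq_2)
qed

text \<open>Equal leading terms mean that the same sequence of maps is applied to \<open>x\<close>
  on both sides, so the two tails share a value.\<close>

lemma eicf_proper_common_drop:
  assumes "eicf_proper b x" "eicf_proper c x" "\<And>i. \<lbrakk>1 \<le> i; i \<le> n\<rbrakk> \<Longrightarrow> b i = c i"
  shows "\<exists>u. eicf_proper (\<lambda>i. b (n + i)) u \<and> eicf_proper (\<lambda>i. c (n + i)) u"
  using assms(3)
proof (induction n)
  case 0
  then show ?case using assms by auto
next
  case (Suc n)
  then obtain u where u: "eicf_proper (\<lambda>i. b (n + i)) u" "eicf_proper (\<lambda>i. c (n + i)) u"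
    by fastforce
  have "b (Suc n) = c (Suc n)" using Suc.prems by simp
  then show ?case
    using eicf_proper_tail[OF u(1)] eicf_proper_tail[OF u(2)] by auto
qed

text \<open>Both first terms lie within 1 of \<open>x\<close>, while distinct even integers are at
  least 2 apart. Hence \<open>x\<close> is their midpoint, the tails have the opposite values 1 and
  -1, and \<open>eicf_proper_unit\<close> determines their terms.\<close>

lemma tails_agree_first_differ:
  assumes b: "eicf_proper b x" and c: "eicf_proper c x" and "b 1 \<noteq> c 1"
  shows "b (Suc (Suc i)) = - c (Suc (Suc i))"
proof -
  define u v where "u = 1 / (x - of_int (b 1))" and "v = 1 / (x - of_int (c 1))"
  note tails = eicf_proper_tail[OF b, folded u_def] eicf_proper_tail[OF c, folded v_def]
  have ne: "b (Suc 1) \<noteq> 0" "c (Suc 1) \<noteq> 0" and ev: "even (b 1)" "even (c 1)"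
    using b c by (simp_all add: eicf_proper_iff)
  have "\<bar>u\<bar> \<ge> 1" "\<bar>v\<bar> \<ge> 1"
    using eicf_proper_abs_ge_1[OF tails(1)] eicf_proper_abs_ge_1[OF tails(2)] ne by simp_all
  then have le: "\<bar>x - of_int (b 1)\<bar> \<le> 1" "\<bar>x - of_int (c 1)\<bar> \<le> 1"
    unfolding u_def v_def by (auto simp: abs_divide le_divide_eq split: if_splits)
  obtain k l where kl: "b 1 = 2 * k" "c 1 = 2 * l" using ev by blast
  have "k + 1 \<le> l \<or> l + 1 \<le> k" using assms(3) kl by linarith
  then have "real_of_int k + 1 \<le> of_int l \<or> real_of_int l + 1 \<le> of_int k" by linarith
  then have "x - of_int (b 1) = 1 \<and> x - of_int (c 1) = -1 \<or>
      x - of_int (b 1) = -1 \<and> x - of_int (c 1) = 1"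
    using le unfolding kl of_int_mult of_int_numeral by (elim disjE) linarith+
  then have uv: "\<bar>u\<bar> = 1" "v = - u" unfolding u_def v_def by auto
  have "of_int (b (Suc (Suc i))) = - real_of_int (c (Suc (Suc i)))"
    using eicf_proper_unit[OF tails(1), of i] eicf_proper_unit[OF tails(2), of i] uv ne by simp
  then show ?thesis by linarith
qed

lemma tails_agree_same_value:
  assumes "eicf_proper b x" "eicf_proper c x"
  shows "tails_agree b c"
proof (cases "\<forall>i \<ge> 1. b i = c i")
  case True
  then show ?thesis unfolding tails_agree_def by (intro exI[of _ 1]) auto
next
  case False
  then obtain k where k: "b (Suc k) \<noteq> c (Suc k)"
    by (metis Suc_le_D One_nat_def)
  \<comment> \<open>\<open>n\<close> is the length of the longest common prefix.\<close>
  define n where "n = (LEAST k. b (Suc k) \<noteq> c (Suc k))"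
  have n: "b (Suc n) \<noteq> c (Suc n)" unfolding n_def using k by (rule LeastI)
  have less: "b (Suc k) = c (Suc k)" if "k < n" for k
    using not_less_Least that unfolding n_def by blast
  have "b i = c i" if "1 \<le> i" "i \<le> n" for i
    using less[of "i - 1"] that by simp
  with eicf_proper_common_drop[OF assms] obtain u
    where u: "eicf_proper (\<lambda>i. b (n + i)) u" "eicf_proper (\<lambda>i. c (n + i)) u" by blast
  \<comment> \<open>The opposite tails begin only after the differing terms at index
    \<open>Suc n\<close>.\<close>
  have "b (Suc n + i) = - c (Suc n + i)" if "i \<ge> 1" for i
    using tails_agree_first_differ[OF u, of "i - 1"] n that by simp
  then show ?thesis unfolding tails_agree_def by blast
qed

section \<open>Action of the group on expansions\<close>

lemma generator_preserves_tails:
  assumes "eicf_proper a x" "g \<in> {theta_s, theta_h, inv_into UNIV theta_h, theta_r}"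
  shows "\<exists>y b. g (Some x) = Some y \<and> eicf_proper b y \<and> tails_agree a b"
proof -
  have ev: "even (a 1)" and a2: "a (Suc 1) \<noteq> 0" using assms(1) by (simp_all add: eicf_proper_iff)
  have x0: "x \<noteq> 0" using eicf_proper_neq_even[OF assms(1), of 0] by simp
  \<comment> \<open>Only the first term changes, to \<open>a 1 + k\<close>, which may be zero in
    that position. The cases \<open>k = 2\<close> and \<open>k = -2\<close> serve
    \<open>theta_h\<close> and its inverse.\<close>
  have shift: "\<exists>b. eicf_proper b (x + of_int k) \<and> tails_agree a b" if "even k" for k
  proof -
    have "eicf_proper (eicf_cons (a 1 + k) (\<lambda>i. a (Suc i))) (x + of_int k)"
      using eicf_proper_cons[OF eicf_proper_tail[OF assms(1)], of "a 1 + k"] ev a2 that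
      by (simp add: algebra_simps)
    moreover have "tails_agree a (eicf_cons (a 1 + k) (\<lambda>i. a (Suc i)))"
      unfolding tails_agree_def eicf_cons_def by (intro exI[of _ 1]) auto
    ultimately show ?thesis by blast
  qed
  from assms(2) consider "g = theta_s" | "g = theta_h" | "g = inv_into UNIV theta_h" | "g = theta_r"
    by blast
  then show ?thesis
  proof cases
    case 1
    have gx: "g (Some x) = Some (- 1 / x)" using 1 x0 by (simp add: theta_s_def)
    show ?thesis
    \<comment> \<open>If \<open>a 1 = 0\<close>, then \<open>1 / x\<close> is the value of the tail,
      so the zero is dropped and the signs change. Otherwise a zero is put in front of the negated
      expansion, whose first term is then a legitimate second term.\<close>
    proof (cases "a 1 = 0")
      case True
      have "eicf_proper (\<lambda>i. - a (Suc i)) (- 1 / x)"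
        using eicf_proper_uminus[OF eicf_proper_tail[OF assms(1)]] True by simp
      moreover have "tails_agree a (\<lambda>i. - a (Suc i))"
        unfolding tails_agree_def by (intro exI[of _ 2] exI[of _ 1]) auto
      ultimately show ?thesis using gx by blast
    next
      case False
      have "eicf_proper (eicf_cons 0 (\<lambda>i. - a i)) (- 1 / x)"
        using eicf_proper_cons[OF eicf_proper_uminus[OF assms(1)], of 0] False by simp
      moreover have "tails_agree a (eicf_cons 0 (\<lambda>i. - a i))"
        unfolding tails_agree_def eicf_cons_def by (intro exI[of _ 1] exI[of _ 2]) auto
      ultimately show ?thesis using gx by blast
    qed
  next
    case 2
    then show ?thesis using shift[of 2] by (simp add: theta_h_def)
  next
    case 3
    have "inj theta_h" using theta_generators_Bij by (auto simp: Bij_def bij_betw_def)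
    then have "g (Some x) = Some (x - 2)"
      unfolding 3 by (intro inv_f_eq) (simp_all add: theta_h_def)
    then show ?thesis using shift[of "-2"] by simp
  next
    case 4
    have "tails_agree a (\<lambda>i. - a i)" unfolding tails_agree_def by (intro exI[of _ 1]) auto
    then show ?thesis using 4 eicf_proper_uminus[OF assms(1)] by (auto simp: theta_r_def)
  qed
qed

lemma theta_group_preserves_tails:
  assumes "g \<in> carrier ext_theta_group" "eicf_proper a x"
  shows "\<exists>y b. g (Some x) = Some y \<and> eicf_proper b y \<and> tails_agree a b"
proof -
  have "g \<in> generate (BijGroup UNIV) {theta_s, theta_h, theta_r}"
    using assms(1) by (simp add: ext_theta_group_def)
  then show ?thesis
    using assms(2)
  proof (induction g arbitrary: a x rule: generate.induct)
    case one
    then show ?case using tails_agree_refl by (auto simp: one_BijGroup_UNIV)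
  next
    case (incl g)
    then show ?case using generator_preserves_tails[of a x g] by blast
  next
    case (inv g)
    \<comment> \<open>Generation also admits inverses of generators; \<open>theta_s\<close> and
      \<open>theta_r\<close> are involutions, so only the inverse of \<open>theta_h\<close> is a new
      map.\<close>
    have "theta_s \<circ> theta_s = id" "theta_r \<circ> theta_r = id"
      by (auto simp: theta_s_def theta_r_def fun_eq_iff option.map_comp o_def option.map_ident
          split: option.splits)
    then have "inv_into UNIV theta_s = theta_s" "inv_into UNIV theta_r = theta_r"
      by (simp_all add: inv_unique_comp)
    then have "inv_into UNIV g \<in> {theta_s, theta_h, inv_into UNIV theta_h, theta_r}"
      using inv.hyps by auto
    moreover have "g \<in> Bij UNIV" using inv.hyps theta_generators_Bij by blast
    ultimately show ?case
      using generator_preserves_tails[OF inv.prems] by (simp add: inv_BijGroup_UNIV)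
  next
    case (eng g h)
    have "g \<in> Bij UNIV" "h \<in> Bij UNIV"
      using eng.hyps carrier_ext_theta_Bij by (simp_all add: ext_theta_group_def)
    then have gh: "(g \<otimes>\<^bsub>BijGroup UNIV\<^esub> h) (Some x) = g (h (Some x))"
      by (simp add: mult_BijGroup_UNIV)
    \<comment> \<open>The image under \<open>h\<close> is finite and again has a proper expansion,
      so the induction hypothesis for \<open>g\<close> applies to it.\<close>
    obtain y b where y: "h (Some x) = Some y" "eicf_proper b y" "tails_agree a b"
      using eng.IH(2)[OF eng.prems] by blast
    obtain z c where "g (Some y) = Some z" "eicf_proper c z" "tails_agree b c"
      using eng.IH(1)[OF y(2)] by blast
    then show ?case using gh y tails_agree_trans by auto
  qed
qed

theorem theorem4p1:
  fixes x y :: real and a b :: "nat \<Rightarrow> int"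
  assumes "Some x \<notin> infty_rationals" and "Some y \<notin> infty_rationals"
    and "eicf_expansion (Infinite a) x" and "eicf_expansion (Infinite b) y"
  shows "theta_equivalent x y \<longleftrightarrow>
    (\<exists>m n. m > 0 \<and> n > 0 \<and>
      ((\<forall>i \<ge> 1. a (m + i) = b (n + i)) \<or> (\<forall>i \<ge> 1. a (m + i) = - b (n + i))))"
proof -
  have a: "eicf_proper a x" and b: "eicf_proper b y"
    using assms by (simp_all add: eicf_proper_def)
  have "theta_related (Some x) (Some y) \<longleftrightarrow> tails_agree a b"
  proof
    assume "theta_related (Some x) (Some y)"
    then obtain g where g: "g \<in> carrier ext_theta_group" "g (Some x) = Some y"
      unfolding theta_related_def by blast
    \<comment> \<open>The expansion \<open>c\<close> carried over from \<open>x\<close> may differ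
      from \<open>b\<close>, since a rational with odd numerator and denominator has two;
      \<open>tails_agree_same_value\<close> bridges the gap.\<close>
    obtain c where "eicf_proper c y" "tails_agree a c"
      using theta_group_preserves_tails[OF g(1) a] g(2) by auto
    then show "tails_agree a b"
      using tails_agree_same_value[OF _ b] tails_agree_trans by blast
  next
    assume "tails_agree a b"
    then obtain m n where mn: "(\<forall>i \<ge> 1. a (m + i) = b (n + i)) \<or> (\<forall>i \<ge> 1. a (m + i) = - b (n + i))"
      unfolding tails_agree_def by blast
    obtain u where u: "eicf_proper (\<lambda>i. a (m + i)) u" "theta_related (Some x) (Some u)"
      using eicf_proper_drop[OF a] by blast
    obtain v where v: "eicf_proper (\<lambda>i. b (n + i)) v" "theta_related (Some y) (Some v)"
      using eicf_proper_drop[OF b] by blast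
    \<comment> \<open>Terms determine the value, so equal tails give equal values and opposite tails
      opposite values; the latter are related by \<open>theta_r\<close>.\<close>
    have "u = v \<or> u = - v"
      using mn
    proof
      assume "\<forall>i \<ge> 1. a (m + i) = b (n + i)"
      then have "eicf_proper (\<lambda>i. a (m + i)) v" by (intro eicf_proper_cong[OF v(1)]) auto
      then show ?thesis using eicf_proper_value_unique[OF u(1)] by blast
    next
      assume "\<forall>i \<ge> 1. a (m + i) = - b (n + i)"
      then have "eicf_proper (\<lambda>i. a (m + i)) (- v)"
        by (intro eicf_proper_cong[OF eicf_proper_uminus[OF v(1)]]) auto
      then show ?thesis using eicf_proper_value_unique[OF u(1)] by blast
    qed
    then have "theta_related (Some u) (Some v)"
      using theta_related_refl theta_related_uminus[of u] by auto
    then show "theta_related (Some x) (Some y)"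
      using u(2) theta_related_sym[OF v(2)] theta_related_trans by blast
  qed
  then show ?thesis by (simp add: theta_equivalent_iff tails_agree_def)
qed

end
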